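(* Let $v,\alpha\in\mathbb{N}_0$. Then for every $n\in\mathbb{N}_0$, $${}_{T}B_{n}^{(c,v+\alpha)}(x,y,z;\lambda)=\sum_{r=0}^n\binom{n}{r}B_{r}^{(v)}(\lambda)\,{}_{T}B_{n-r}^{(c,\alpha)}(x,y,z;\lambda)$$ and $${}_{T}B_{n}^{(s,v+\alpha)}(x,y,z;\lambda)=\sum_{r=0}^n\binom{n}{r}B_{r}^{(v)}(\lambda)\,{}_{T}B_{n-r}^{(s,\alpha)}(x,y,z;\lambda).$$
   Context: $\mathbb{N}_0=\{0,1,2,\dots\}$; $x,y,z$ are variables (taking complex values) and $\lambda\in\mathbb{C}\setminus\{0\}$. Let $\mathcal{U}(y,t)=\sum_{n\ge0}\mathcal{U}_n(y)\frac{t^n}{n!}$ be a power series in $t$ with coefficients depending on $y$ and $\mathcal{U}_0(y)\neq0$; the 2-variable general polynomials $T_n(x,y)$ are defined by $e^{xt}\mathcal{U}(y,t)=\sum_{n\ge0}T_n(x,y)\frac{t^n}{n!}$, with the normalization $T_0(x,y)=1$. For an order $v\in\mathbb{N}_0$, the parametric kinds of generalized Apostol--Bernoulli polynomials are defined, as power series in $t$, by $$\Bigl(\frac{t}{\lambda e^t-1}\Bigr)^v e^{xt}\,\mathcal{U}(y,t)\cos(zt)=\sum_{n=0}^\infty {}_{T}B_{n}^{(c,v)}(x,y,z;\lambda)\frac{t^n}{n!},$$ $$\Bigl(\frac{t}{\lambda e^t-1}\Bigr)^v e^{xt}\,\mathcal{U}(y,t)\sin(zt)=\sum_{n=0}^\infty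 {}_{T}B_{n}^{(s,v)}(x,y,z;\lambda)\frac{t^n}{n!}.$$ The Apostol--Bernoulli numbers $B_n^{(v)}(\lambda)$ of order $v$ are defined by $\bigl(\frac{t}{\lambda e^t-1}\bigr)^v=\sum_{n=0}^\infty B_n^{(v)}(\lambda)\frac{t^n}{n!}$. *)

theory Defs
  imports "HOL-Computational_Algebra.Computational_Algebra" "HOL.Complex"
begin

text \<open>
  All generating functions are formal power series in \<open>t\<close> over the complex numbers; \<open>x\<close>, \<open>y\<close>, \<open>z\<close>
  and \<open>\<lambda>\<close> are complex numbers.  The series \<open>\<U>(y,t)\<close> is given by its coefficient functions
  \<open>U n y\<close>, i.e. the coefficient of \<open>t ^ n / n!\<close> at \<open>y\<close>.
\<close>

definition egf :: "(nat \<Rightarrow> complex) \<Rightarrow> complex fps" where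
  "egf a = Abs_fps (\<lambda>n. a n / fact n)"

definition egf_coeff :: "complex fps \<Rightarrow> nat \<Rightarrow> complex" where
  "egf_coeff F n = fact n * fps_nth F n"

lemma egf_eq_iff: "egf a = F \<longleftrightarrow> a = egf_coeff F"
  by (auto simp: egf_def egf_coeff_def fps_eq_iff fun_eq_iff field_simps)

definition two_var_poly :: "(nat \<Rightarrow> complex \<Rightarrow> complex) \<Rightarrow> nat \<Rightarrow> complex \<Rightarrow> complex \<Rightarrow> complex" where
  "two_var_poly U n x y = egf_coeff (fps_exp x * egf (\<lambda>k. U k y)) n"

text \<open>
  For \<open>\<lambda> = 1\<close> the denominator has no inverse as a power series.  Division of formal power series
  over a field cancels the common power of \<open>t\<close>, so the quotient is the intended one in all cases.
\<close>

definition apostol_bernoulli_fps :: "complex \<Rightarrow> complex fps" where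
  "apostol_bernoulli_fps l = fps_X / (fps_const l * fps_exp 1 - 1)"

lemma apostol_bernoulli_fps_mult:
  "(fps_const l * fps_exp 1 - 1) * apostol_bernoulli_fps l = fps_X"
proof -
  let ?g = "fps_const l * fps_exp 1 - 1 :: complex fps"
  have nz: "fps_nth ?g 0 \<noteq> 0 \<or> fps_nth ?g 1 \<noteq> 0"
    by auto
  then have "subdegree ?g \<le> 1"
    using subdegree_leI[of ?g 0] subdegree_leI[of ?g 1] by linarith
  moreover have "?g \<noteq> 0"
    using nz by (metis fps_zero_nth)
  ultimately have "?g dvd fps_X"
    by (simp add: fps_dvd_iff)
  then show ?thesis
    unfolding apostol_bernoulli_fps_def by (rule dvd_mult_div_cancel)
qed

definition apostol_bernoulli_number :: "nat \<Rightarrow> complex \<Rightarrow> nat \<Rightarrow> complex" where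
  "apostol_bernoulli_number v l n = egf_coeff (apostol_bernoulli_fps l ^ v) n"

definition TB_cos ::
  "(nat \<Rightarrow> complex \<Rightarrow> complex) \<Rightarrow> nat \<Rightarrow> nat \<Rightarrow> complex \<Rightarrow> complex \<Rightarrow> complex \<Rightarrow> complex \<Rightarrow> complex" where
  "TB_cos U v n x y z l =
     egf_coeff (apostol_bernoulli_fps l ^ v * fps_exp x * egf (\<lambda>k. U k y) * fps_cos z) n"

definition TB_sin ::
  "(nat \<Rightarrow> complex \<Rightarrow> complex) \<Rightarrow> nat \<Rightarrow> nat \<Rightarrow> complex \<Rightarrow> complex \<Rightarrow> complex \<Rightarrow> complex \<Rightarrow> complex" where
  "TB_sin U v n x y z l =
     egf_coeff (apostol_bernoulli_fps l ^ v * fps_exp x * egf (\<lambda>k. U k y) * fps_sin z) n"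

end

theory Submission
  imports Defs
begin

text \<open>The order-(v + \<alpha>) generating function is
  \<open>apostol_bernoulli_fps l ^ v\<close> times the order-\<alpha> one, and multiplying
  exponential generating functions convolves their coefficients binomially
  (\<open>egf_coeff_mult\<close>).\<close>

lemma egf_coeff_mult:
  "egf_coeff (F * G) n = (\<Sum>r=0..n. of_nat (n choose r) * egf_coeff F r * egf_coeff G (n - r))"
  unfolding egf_coeff_def fps_mult_nth sum_distrib_left
  by (rule sum.cong) (simp_all add: binomial_fact)

theorem theorem3p6:
  fixes U :: "nat \<Rightarrow> complex \<Rightarrow> complex" and x y z l :: complex and v \<alpha> n :: nat
  assumes "l \<noteq> 0"
    and "\<And>y. U 0 y \<noteq> 0"
    and "\<And>x y. two_var_poly U 0 x y = 1"
  shows "TB_cos U (v + \<alpha>) n x y z l =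
           (\<Sum>r=0..n. of_nat (n choose r) * apostol_bernoulli_number v l r * TB_cos U \<alpha> (n - r) x y z l)
       \<and> TB_sin U (v + \<alpha>) n x y z l =
           (\<Sum>r=0..n. of_nat (n choose r) * apostol_bernoulli_number v l r * TB_sin U \<alpha> (n - r) x y z l)"
  \<comment> \<open>Read right to left, \<open>egf_coeff_mult\<close> folds each sum into one
    coefficient of a product; \<open>power_add\<close> and left-nested products then make both sides
    agree.\<close>
  by (simp add: TB_cos_def TB_sin_def apostol_bernoulli_number_def egf_coeff_mult [symmetric]
      power_add flip: mult.assoc)

end
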